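(* Let $\mathcal R_1$ and $\mathcal R_2$ be two $\Sigma$-structures that are one-binding bisimilar. Then for every OBFOL sentence $\varphi$ over $\Sigma(\mathrm{Var})$, $\mathcal R_1\models\varphi$ iff $\mathcal R_2\models\varphi$.
   Context: Language signature $\Sigma=(\mathrm{Args},\mathrm{Rels},\mathrm{ar})$: $\mathrm{Args},\mathrm{Rels}$ finite non-empty, $\mathrm{ar}:\mathrm{Rels}\to\mathcal P(\mathrm{Args})\setminus\{\emptyset\}$. A $\Sigma$-structure $\mathcal R=(D,\cdot^{\mathcal R})$ has non-empty domain $D$ and, for each $r$, a set $r^{\mathcal R}$ of functions $\mathrm{ar}(r)\to D$. FOL formulas: $\varphi::= r\mid\neg\varphi\mid\varphi\wedge\varphi\mid\varphi\vee\varphi\mid\exists x.\varphi\mid\forall x.\varphi\mid(a,x)\varphi$. Free placeholders: $\mathrm{free}(r)=\mathrm{ar}(r)$; unchanged by $\neg$; union for $\wedge,\vee$; $\mathrm{free}(Qx.\varphi)=\mathrm{free}(\varphi)\setminus\{x\}$; $\mathrm{free}((a,x)\varphi)=(\mathrm{free}(\varphi)\setminus\{a\})\cup\{x\}$ if $a\in\mathrm{free}(\varphi)$, else $\mathrm{free}(\varphi)$; sentences have none. Semantics with partial assignments $\chi:\mathrm{Args}\cup\mathrm{Var}\rightharpoonup D$: $\mathcal R,\chi\models r$ iff $\chi|_{\mathrm{ar}(r)}\in r^{\mathcal R}$; usual Boolean and quantifier clauses; $\mathcal R,\chi\models(a,x)\varphi$ iff $\mathcal R,\chi[a\mapsto\chi(x)]\models\varphi$;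 $\mathcal R\models\varphi$ iff $\mathcal R,\emptyset\models\varphi$. A quantification prefix is a finite word over $\{\exists x,\forall x\}$ with each variable at most once; a binding prefix is a finite word over pairs $(a,x)$ with each argument at most once; a derived relation is a Boolean combination of relations all having the same argument set. OBFOL formulas: $\varphi::=\wp\flat\bar r\mid(\varphi\wedge\varphi)\mid(\varphi\vee\varphi)$ with $\wp$ a quantification prefix, $\flat$ a binding prefix, $\bar r$ a derived relation. For a set $A\subseteq\mathrm{Args}$ and domain $D$, $\mathrm{Asg}_D(A)$ is the set of functions $A\to D$. For an assignment $\chi$, a set $P$ and $d\in D$, $\chi[P\mapsto d]$ is the assignment on $\mathrm{dom}(\chi)\cup P$ equal to $d$ on $P$ and to $\chi$ elsewhere. Structures $\mathcal R_1=(D_1,\cdot^{\mathcal R_1})$, $\mathcal R_2=(D_2,\cdot^{\mathcal R_2})$ are one-binding bisimilar iff there is a total relation $Z\subseteq\bigcup_{A\subseteq\mathrm{Args}}\mathrm{Asg}_{D_1}(A)\times\mathrm{Asg}_{D_2}(A)$ such that: (1) for all $A\subseteq\mathrm{Args}$, $A'\subseteq\mathrm{Args}\setminus A$, $\chi_1\in\mathrm{Asg}_{D_1}(A)$, $\chi_2\in\mathrm{Asg}_{D_2}(A)$ with $\chi_1 Z\chi_2$: (forth) for every $d_1\in D_1$ there is $d_2\in D_2$ with $\chi_1[A'\mapsto d_1]\,Z\,\chi_2[A'\mapsto d_2]$; (back) for every $d_2\in D_2$ there is $d_1\in D_1$ with $\chi_1[A'\mapsto d_1]\,Z\,\chi_2[A'\mapsto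 d_2]$; (2) for all $r\in\mathrm{Rels}$, $\chi_1\in\mathrm{Asg}_{D_1}(\mathrm{ar}(r))$, $\chi_2\in\mathrm{Asg}_{D_2}(\mathrm{ar}(r))$ with $\chi_1Z\chi_2$: $\chi_1\in r^{\mathcal R_1}$ iff $\chi_2\in r^{\mathcal R_2}$. *)

theory Defs
  imports Main
begin

record ('a, 'r) signature =
  Args :: "'a set"
  Rels :: "'r set"
  ar :: "'r \<Rightarrow> 'a set"

definition wf_signature :: "('a, 'r) signature \<Rightarrow> bool" where
  "wf_signature \<Sigma> \<longleftrightarrow>
     finite (Args \<Sigma>) \<and> Args \<Sigma> \<noteq> {} \<and>
     finite (Rels \<Sigma>) \<and> Rels \<Sigma> \<noteq> {} \<and>
     (\<forall>r \<in> Rels \<Sigma>. ar \<Sigma> r \<subseteq> Args \<Sigma> \<and> ar \<Sigma> r \<noteq> {})"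

text \<open>Functions \<open>A \<rightarrow> D\<close> are represented by the partial maps whose domain is exactly \<open>A\<close>.\<close>

definition Asg :: "'d set \<Rightarrow> 'a set \<Rightarrow> ('a \<rightharpoonup> 'd) set" where
  "Asg D A = {\<chi>. dom \<chi> = A \<and> ran \<chi> \<subseteq> D}"

record ('a, 'r, 'd) struct =
  Dom :: "'d set"
  interp :: "'r \<Rightarrow> ('a \<rightharpoonup> 'd) set"

definition is_structure :: "('a, 'r) signature \<Rightarrow> ('a, 'r, 'd) struct \<Rightarrow> bool" where
  "is_structure \<Sigma> \<R> \<longleftrightarrow>
     Dom \<R> \<noteq> {} \<and> (\<forall>r \<in> Rels \<Sigma>. interp \<R> r \<subseteq> Asg (Dom \<R>) (ar \<Sigma> r))"

datatype ('a, 'r, 'v) fol =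
    Rel 'r
  | Neg "('a, 'r, 'v) fol"
  | Conj "('a, 'r, 'v) fol" "('a, 'r, 'v) fol"
  | Disj "('a, 'r, 'v) fol" "('a, 'r, 'v) fol"
  | Ex 'v "('a, 'r, 'v) fol"
  | All 'v "('a, 'r, 'v) fol"
  | Bind 'a 'v "('a, 'r, 'v) fol"

text \<open>Placeholders are the elements of the disjoint union of arguments (\<open>Inl\<close>) and
  variables (\<open>Inr\<close>).\<close>

primrec free :: "('a, 'r) signature \<Rightarrow> ('a, 'r, 'v) fol \<Rightarrow> ('a + 'v) set" where
  "free \<Sigma> (Rel r) = Inl ` ar \<Sigma> r"
| "free \<Sigma> (Neg \<phi>) = free \<Sigma> \<phi>"
| "free \<Sigma> (Conj \<phi> \<psi>) = free \<Sigma> \<phi> \<union> free \<Sigma> \<psi>"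
| "free \<Sigma> (Disj \<phi> \<psi>) = free \<Sigma> \<phi> \<union> free \<Sigma> \<psi>"
| "free \<Sigma> (Ex x \<phi>) = free \<Sigma> \<phi> - {Inr x}"
| "free \<Sigma> (All x \<phi>) = free \<Sigma> \<phi> - {Inr x}"
| "free \<Sigma> (Bind a x \<phi>) =
     (if Inl a \<in> free \<Sigma> \<phi> then (free \<Sigma> \<phi> - {Inl a}) \<union> {Inr x} else free \<Sigma> \<phi>)"

definition sentence :: "('a, 'r) signature \<Rightarrow> ('a, 'r, 'v) fol \<Rightarrow> bool" where
  "sentence \<Sigma> \<phi> \<longleftrightarrow> free \<Sigma> \<phi> = {}"

text \<open>In the binding clause, \<open>a\<close> becomes undefined if \<open>x\<close> is; when \<open>\<chi>\<close> is defined on all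
  free placeholders this can only happen for an \<open>a\<close> that is not free in \<open>\<phi>\<close>.\<close>

primrec sat ::
  "('a, 'r) signature \<Rightarrow> ('a, 'r, 'd) struct \<Rightarrow> ('a + 'v \<rightharpoonup> 'd) \<Rightarrow> ('a, 'r, 'v) fol \<Rightarrow> bool" where
  "sat \<Sigma> \<R> \<chi> (Rel r) \<longleftrightarrow> (\<chi> \<circ> Inl) |` ar \<Sigma> r \<in> interp \<R> r"
| "sat \<Sigma> \<R> \<chi> (Neg \<phi>) \<longleftrightarrow> \<not> sat \<Sigma> \<R> \<chi> \<phi>"
| "sat \<Sigma> \<R> \<chi> (Conj \<phi> \<psi>) \<longleftrightarrow> sat \<Sigma> \<R> \<chi> \<phi> \<and> sat \<Sigma> \<R> \<chi> \<psi>"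
| "sat \<Sigma> \<R> \<chi> (Disj \<phi> \<psi>) \<longleftrightarrow> sat \<Sigma> \<R> \<chi> \<phi> \<or> sat \<Sigma> \<R> \<chi> \<psi>"
| "sat \<Sigma> \<R> \<chi> (Ex x \<phi>) \<longleftrightarrow> (\<exists>d \<in> Dom \<R>. sat \<Sigma> \<R> (\<chi>(Inr x \<mapsto> d)) \<phi>)"
| "sat \<Sigma> \<R> \<chi> (All x \<phi>) \<longleftrightarrow> (\<forall>d \<in> Dom \<R>. sat \<Sigma> \<R> (\<chi>(Inr x \<mapsto> d)) \<phi>)"
| "sat \<Sigma> \<R> \<chi> (Bind a x \<phi>) \<longleftrightarrow> sat \<Sigma> \<R> (\<chi>(Inl a := \<chi> (Inr x))) \<phi>"

definition models :: "('a, 'r) signature \<Rightarrow> ('a, 'r, 'd) struct \<Rightarrow> ('a, 'r, 'v) fol \<Rightarrow> bool" where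
  "models \<Sigma> \<R> \<phi> \<longleftrightarrow> sat \<Sigma> \<R> Map.empty \<phi>"

datatype 'v quant = QEx (qvar: 'v) | QAll (qvar: 'v)

definition quant_prefix :: "'v quant list \<Rightarrow> bool" where
  "quant_prefix qs \<longleftrightarrow> distinct (map qvar qs)"

definition bind_prefix :: "('a, 'r) signature \<Rightarrow> ('a \<times> 'v) list \<Rightarrow> bool" where
  "bind_prefix \<Sigma> bs \<longleftrightarrow> distinct (map fst bs) \<and> fst ` set bs \<subseteq> Args \<Sigma>"

primrec quantify :: "'v quant list \<Rightarrow> ('a, 'r, 'v) fol \<Rightarrow> ('a, 'r, 'v) fol" where
  "quantify [] \<phi> = \<phi>"
| "quantify (q # qs) \<phi> =
     (case q of QEx x \<Rightarrow> Ex x (quantify qs \<phi>) | QAll x \<Rightarrow> All x (quantify qs \<phi>))"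

primrec bind :: "('a \<times> 'v) list \<Rightarrow> ('a, 'r, 'v) fol \<Rightarrow> ('a, 'r, 'v) fol" where
  "bind [] \<phi> = \<phi>"
| "bind (b # bs) \<phi> = Bind (fst b) (snd b) (bind bs \<phi>)"

inductive bool_comb :: "('a, 'r) signature \<Rightarrow> 'a set \<Rightarrow> ('a, 'r, 'v) fol \<Rightarrow> bool"
  for \<Sigma> :: "('a, 'r) signature" and A :: "'a set" where
  Rel: "r \<in> Rels \<Sigma> \<Longrightarrow> ar \<Sigma> r = A \<Longrightarrow> bool_comb \<Sigma> A (Rel r)"
| Neg: "bool_comb \<Sigma> A \<phi> \<Longrightarrow> bool_comb \<Sigma> A (Neg \<phi>)"
| Conj: "bool_comb \<Sigma> A \<phi> \<Longrightarrow> bool_comb \<Sigma> A \<psi> \<Longrightarrow> bool_comb \<Sigma> A (Conj \<phi> \<psi>)"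
| Disj: "bool_comb \<Sigma> A \<phi> \<Longrightarrow> bool_comb \<Sigma> A \<psi> \<Longrightarrow> bool_comb \<Sigma> A (Disj \<phi> \<psi>)"

definition derived_relation :: "('a, 'r) signature \<Rightarrow> ('a, 'r, 'v) fol \<Rightarrow> bool" where
  "derived_relation \<Sigma> \<phi> \<longleftrightarrow> (\<exists>A. bool_comb \<Sigma> A \<phi>)"

inductive obfol :: "('a, 'r) signature \<Rightarrow> ('a, 'r, 'v) fol \<Rightarrow> bool"
  for \<Sigma> :: "('a, 'r) signature" where
  Prefix: "quant_prefix qs \<Longrightarrow> bind_prefix \<Sigma> bs \<Longrightarrow> derived_relation \<Sigma> \<rho> \<Longrightarrow>
     obfol \<Sigma> (quantify qs (bind bs \<rho>))"
| Conj: "obfol \<Sigma> \<phi> \<Longrightarrow> obfol \<Sigma> \<psi> \<Longrightarrow> obfol \<Sigma> (Conj \<phi> \<psi>)"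
| Disj: "obfol \<Sigma> \<phi> \<Longrightarrow> obfol \<Sigma> \<psi> \<Longrightarrow> obfol \<Sigma> (Disj \<phi> \<psi>)"

definition upd_on :: "('a \<rightharpoonup> 'd) \<Rightarrow> 'a set \<Rightarrow> 'd \<Rightarrow> ('a \<rightharpoonup> 'd)" where
  "upd_on \<chi> P d = (\<lambda>a. if a \<in> P then Some d else \<chi> a)"

text \<open>A total relation is one relating every element of the left-hand side to something.\<close>

definition one_binding_bisimulation ::
  "('a, 'r) signature \<Rightarrow> ('a, 'r, 'd1) struct \<Rightarrow> ('a, 'r, 'd2) struct \<Rightarrow>
   (('a \<rightharpoonup> 'd1) \<times> ('a \<rightharpoonup> 'd2)) set \<Rightarrow> bool" where
  "one_binding_bisimulation \<Sigma> \<R>1 \<R>2 Z \<longleftrightarrow>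
     Z \<subseteq> (\<Union>A \<in> Pow (Args \<Sigma>). Asg (Dom \<R>1) A \<times> Asg (Dom \<R>2) A) \<and>
     (\<forall>\<chi>1 \<in> (\<Union>A \<in> Pow (Args \<Sigma>). Asg (Dom \<R>1) A). \<exists>\<chi>2. (\<chi>1, \<chi>2) \<in> Z) \<and>
     (\<forall>A A' \<chi>1 \<chi>2. A \<subseteq> Args \<Sigma> \<longrightarrow> A' \<subseteq> Args \<Sigma> - A \<longrightarrow>
        \<chi>1 \<in> Asg (Dom \<R>1) A \<longrightarrow> \<chi>2 \<in> Asg (Dom \<R>2) A \<longrightarrow> (\<chi>1, \<chi>2) \<in> Z \<longrightarrow>
        (\<forall>d1 \<in> Dom \<R>1. \<exists>d2 \<in> Dom \<R>2. (upd_on \<chi>1 A' d1, upd_on \<chi>2 A' d2) \<in> Z) \<and>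
        (\<forall>d2 \<in> Dom \<R>2. \<exists>d1 \<in> Dom \<R>1. (upd_on \<chi>1 A' d1, upd_on \<chi>2 A' d2) \<in> Z)) \<and>
     (\<forall>r \<in> Rels \<Sigma>. \<forall>\<chi>1 \<in> Asg (Dom \<R>1) (ar \<Sigma> r). \<forall>\<chi>2 \<in> Asg (Dom \<R>2) (ar \<Sigma> r).
        (\<chi>1, \<chi>2) \<in> Z \<longrightarrow> (\<chi>1 \<in> interp \<R>1 r \<longleftrightarrow> \<chi>2 \<in> interp \<R>2 r))"

definition one_binding_bisimilar ::
  "('a, 'r) signature \<Rightarrow> ('a, 'r, 'd1) struct \<Rightarrow> ('a, 'r, 'd2) struct \<Rightarrow> bool" where
  "one_binding_bisimilar \<Sigma> \<R>1 \<R>2 \<longleftrightarrow> (\<exists>Z. one_binding_bisimulation \<Sigma> \<R>1 \<R>2 Z)"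

end

theory Submission
  imports Defs
begin

text \<open>An assignment \<open>\<chi>\<close> and a binding prefix \<open>\<flat>\<close> induce an assignment of the arguments \<open>A\<close> of the
  derived relation, and that is all the matrix of \<open>\<wp>\<flat>\<rho>\<close> sees. Quantifying a fresh variable \<open>x\<close>
  updates this induced assignment with one value on exactly those arguments that \<open>\<flat>\<close> binds to \<open>x\<close>,
  a set disjoint from its current domain; so each quantifier is matched by one back-and-forth step,
  starting from the pair of empty assignments, which totality of the bisimulation provides.\<close>

section \<open>Assignments induced by a binding prefix\<close>

text \<open>The sequential bindings are read as one simultaneous lookup. Each takes its value from a
  variable, and no binding changes a variable, so for distinct arguments the order is
  irrelevant.\<close>

definition arg_asg :: "('a \<times> 'v) list \<Rightarrow> ('a + 'v \<rightharpoonup> 'd) \<Rightarrow> ('a \<rightharpoonup> 'd)" where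
  "arg_asg bs \<chi> a = (case map_of bs a of None \<Rightarrow> \<chi> (Inl a) | Some x \<Rightarrow> \<chi> (Inr x))"

lemma arg_asg_Nil: "arg_asg [] \<chi> = \<chi> \<circ> Inl"
  by (auto simp: arg_asg_def)

lemma arg_asg_empty: "arg_asg bs Map.empty = Map.empty"
  by (auto simp: arg_asg_def split: option.splits)

text \<open>Distinctness matters: the innermost of several bindings of an argument would win in the
  semantics, but the outermost one in \<^const>\<open>map_of\<close>.\<close>

lemma arg_asg_Cons:
  assumes "a \<notin> fst ` set bs"
  shows "arg_asg ((a, x) # bs) \<chi> = arg_asg bs (\<chi>(Inl a := \<chi> (Inr x)))"
proof
  fix c
  have "map_of bs a = None"
    using assms by (simp add: map_of_eq_None_iff)
  then show "arg_asg ((a, x) # bs) \<chi> c = arg_asg bs (\<chi>(Inl a := \<chi> (Inr x))) c"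
    by (auto simp: arg_asg_def split: option.splits)
qed

text \<open>As \<open>x\<close> has no value yet, the arguments looked up at \<open>x\<close> are
  still undefined; giving \<open>x\<close> a value fills these, and every other argument is looked
  up elsewhere.\<close>

lemma arg_asg_quantified:
  assumes "\<chi> (Inr x) = None" and "P = {a \<in> A. map_of bs a = Some x}"
  shows "arg_asg bs (\<chi>(Inr x \<mapsto> d)) |` A = upd_on (arg_asg bs \<chi> |` A) P d"
    and "P \<inter> dom (arg_asg bs \<chi> |` A) = {}"
  using assms
  by (auto simp: fun_eq_iff arg_asg_def upd_on_def restrict_map_def split: option.splits if_splits)

lemma free_bool_comb: "bool_comb \<Sigma> A \<rho> \<Longrightarrow> free \<Sigma> \<rho> = Inl ` A"
  by (induction rule: bool_comb.induct) auto

text \<open>The only binding that can affect \<open>a\<close> is its own, which trades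
  \<open>Inl a\<close> for its variable. The others remove only other arguments and never a
  variable.\<close>

lemma free_bind:
  assumes "distinct (map fst bs)" and "Inl a \<in> free \<Sigma> \<phi>"
  shows "(case map_of bs a of None \<Rightarrow> Inl a | Some x \<Rightarrow> Inr x) \<in> free \<Sigma> (bind bs \<phi>)"
  using assms
proof (induction bs)
  case (Cons b bs)
  show ?case
  proof (cases "a = fst b")
    case True
    then have "map_of bs a = None"
      using Cons.prems by (simp add: map_of_eq_None_iff)
    then show ?thesis
      using Cons True by (cases b) auto
  next
    case False
    then show ?thesis
      using Cons by (cases b) (auto split: option.splits)
  qed
qed simp

text \<open>Needed because a bisimulation compares a relation only on assignments whose domain is
  exactly its argument set.\<close>

lemma arg_asg_bind_total:
  assumes "distinct (map fst bs)" and "Inl ` A \<subseteq> free \<Sigma> \<phi>"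
    and "free \<Sigma> (bind bs \<phi>) \<subseteq> dom \<chi>"
  shows "dom (arg_asg bs \<chi> |` A) = A"
proof -
  have "arg_asg bs \<chi> a \<noteq> None" if "a \<in> A" for a
  proof -
    have "(case map_of bs a of None \<Rightarrow> Inl a | Some x \<Rightarrow> Inr x) \<in> dom \<chi>"
      using free_bind[OF assms(1), of a \<Sigma> \<phi>] assms(2,3) that by blast
    then show ?thesis
      by (auto simp: arg_asg_def split: option.splits)
  qed
  then show ?thesis
    by auto
qed

section \<open>Truth of the matrix\<close>

lemma sat_bool_comb_cong:
  assumes "bool_comb \<Sigma> A \<rho>"
    and "\<And>r. r \<in> Rels \<Sigma> \<Longrightarrow> ar \<Sigma> r = A \<Longrightarrow>
      (\<chi>1 \<circ> Inl) |` A \<in> interp \<R>1 r \<longleftrightarrow> (\<chi>2 \<circ> Inl) |` A \<in> interp \<R>2 r"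
  shows "sat \<Sigma> \<R>1 \<chi>1 \<rho> \<longleftrightarrow> sat \<Sigma> \<R>2 \<chi>2 \<rho>"
  using assms(1) by (induction rule: bool_comb.induct) (simp_all add: assms(2)[simplified])

text \<open>Executing the outermost binding moves it from the list into the assignment and leaves
  the induced assignment unchanged.\<close>

lemma sat_bind_bool_comb_cong:
  assumes "bool_comb \<Sigma> A \<rho>" and "distinct (map fst bs)"
    and "\<And>r. r \<in> Rels \<Sigma> \<Longrightarrow> ar \<Sigma> r = A \<Longrightarrow>
      arg_asg bs \<chi>1 |` A \<in> interp \<R>1 r \<longleftrightarrow> arg_asg bs \<chi>2 |` A \<in> interp \<R>2 r"
  shows "sat \<Sigma> \<R>1 \<chi>1 (bind bs \<rho>) \<longleftrightarrow> sat \<Sigma> \<R>2 \<chi>2 (bind bs \<rho>)"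
  using assms(2,3)
proof (induction bs arbitrary: \<chi>1 \<chi>2)
  case Nil
  then show ?case
    unfolding bind.simps arg_asg_Nil by (intro sat_bool_comb_cong[OF assms(1)])
next
  case (Cons b bs)
  obtain a x where b: "b = (a, x)"
    by (cases b)
  with Cons.prems(1) have "a \<notin> fst ` set bs"
    by simp
  then have "sat \<Sigma> \<R>1 (\<chi>1(Inl a := \<chi>1 (Inr x))) (bind bs \<rho>)
      \<longleftrightarrow> sat \<Sigma> \<R>2 (\<chi>2(Inl a := \<chi>2 (Inr x))) (bind bs \<rho>)"
    using Cons.prems by (intro Cons.IH) (simp_all add: b arg_asg_Cons fun_upd_def)
  then show ?case
    by (simp add: b)
qed

section \<open>Back and forth along a bisimulation\<close>

context
  fixes \<Sigma> :: "('a, 'r) signature"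
    and \<R>1 :: "('a, 'r, 'd1) struct"
    and \<R>2 :: "('a, 'r, 'd2) struct"
    and Z
  assumes bisim: "one_binding_bisimulation \<Sigma> \<R>1 \<R>2 Z"
begin

text \<open>Recovers the common argument set of a related pair as \<open>dom \<chi>1\<close>, so
  that it need not be carried along as a parameter.\<close>

lemma bisimulation_Asg:
  assumes "(\<chi>1, \<chi>2) \<in> Z"
  shows "dom \<chi>1 \<subseteq> Args \<Sigma>" and "\<chi>1 \<in> Asg (Dom \<R>1) (dom \<chi>1)" and "\<chi>2 \<in> Asg (Dom \<R>2) (dom \<chi>1)"
proof -
  have "Z \<subseteq> (\<Union>A \<in> Pow (Args \<Sigma>). Asg (Dom \<R>1) A \<times> Asg (Dom \<R>2) A)"
    using bisim unfolding one_binding_bisimulation_def by (elim conjE)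
  with assms obtain A where "A \<subseteq> Args \<Sigma>" "\<chi>1 \<in> Asg (Dom \<R>1) A" "\<chi>2 \<in> Asg (Dom \<R>2) A"
    by blast
  moreover from this have "dom \<chi>1 = A"
    by (simp add: Asg_def)
  ultimately show "dom \<chi>1 \<subseteq> Args \<Sigma>" "\<chi>1 \<in> Asg (Dom \<R>1) (dom \<chi>1)" "\<chi>2 \<in> Asg (Dom \<R>2) (dom \<chi>1)"
    by simp_all
qed

text \<open>Totality gives the empty assignment some partner, and related assignments have equal
  domains.\<close>

lemma bisimulation_empty: "(Map.empty, Map.empty) \<in> Z"
proof -
  have "\<forall>\<chi>1 \<in> (\<Union>A \<in> Pow (Args \<Sigma>). Asg (Dom \<R>1) A). \<exists>\<chi>2. (\<chi>1, \<chi>2) \<in> Z"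
    using bisim unfolding one_binding_bisimulation_def by (elim conjE)
  moreover have "Map.empty \<in> Asg (Dom \<R>1) {}"
    by (simp add: Asg_def)
  ultimately obtain \<chi>2 where \<chi>2: "(Map.empty, \<chi>2) \<in> Z"
    by blast
  from bisimulation_Asg(3)[OF this] have "\<chi>2 = Map.empty"
    by (simp add: Asg_def)
  with \<chi>2 show ?thesis
    by simp
qed

lemma bisimulation_step:
  assumes "(\<chi>1, \<chi>2) \<in> Z" and "P \<subseteq> Args \<Sigma>" and "P \<inter> dom \<chi>1 = {}"
  shows "\<forall>d1 \<in> Dom \<R>1. \<exists>d2 \<in> Dom \<R>2. (upd_on \<chi>1 P d1, upd_on \<chi>2 P d2) \<in> Z"
    and "\<forall>d2 \<in> Dom \<R>2. \<exists>d1 \<in> Dom \<R>1. (upd_on \<chi>1 P d1, upd_on \<chi>2 P d2) \<in> Z"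
proof -
  have "\<forall>A A' \<chi>1 \<chi>2. A \<subseteq> Args \<Sigma> \<longrightarrow> A' \<subseteq> Args \<Sigma> - A \<longrightarrow>
        \<chi>1 \<in> Asg (Dom \<R>1) A \<longrightarrow> \<chi>2 \<in> Asg (Dom \<R>2) A \<longrightarrow> (\<chi>1, \<chi>2) \<in> Z \<longrightarrow>
        (\<forall>d1 \<in> Dom \<R>1. \<exists>d2 \<in> Dom \<R>2. (upd_on \<chi>1 A' d1, upd_on \<chi>2 A' d2) \<in> Z) \<and>
        (\<forall>d2 \<in> Dom \<R>2. \<exists>d1 \<in> Dom \<R>1. (upd_on \<chi>1 A' d1, upd_on \<chi>2 A' d2) \<in> Z)"
    using bisim unfolding one_binding_bisimulation_def by (elim conjE)
  moreover have "P \<subseteq> Args \<Sigma> - dom \<chi>1"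
    using assms by blast
  ultimately show
    "\<forall>d1 \<in> Dom \<R>1. \<exists>d2 \<in> Dom \<R>2. (upd_on \<chi>1 P d1, upd_on \<chi>2 P d2) \<in> Z"
    "\<forall>d2 \<in> Dom \<R>2. \<exists>d1 \<in> Dom \<R>1. (upd_on \<chi>1 P d1, upd_on \<chi>2 P d2) \<in> Z"
    using assms(1) bisimulation_Asg[OF assms(1)] by simp_all
qed

lemma bisimulation_interp:
  assumes "(\<chi>1, \<chi>2) \<in> Z" and "r \<in> Rels \<Sigma>" and "dom \<chi>1 = ar \<Sigma> r"
  shows "\<chi>1 \<in> interp \<R>1 r \<longleftrightarrow> \<chi>2 \<in> interp \<R>2 r"
proof -
  have "\<forall>r \<in> Rels \<Sigma>. \<forall>\<chi>1 \<in> Asg (Dom \<R>1) (ar \<Sigma> r). \<forall>\<chi>2 \<in> Asg (Dom \<R>2) (ar \<Sigma> r).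
        (\<chi>1, \<chi>2) \<in> Z \<longrightarrow> (\<chi>1 \<in> interp \<R>1 r \<longleftrightarrow> \<chi>2 \<in> interp \<R>2 r)"
    using bisim unfolding one_binding_bisimulation_def by (elim conjE)
  then show ?thesis
    using assms bisimulation_Asg(2,3)[OF assms(1)] by simp
qed

text \<open>Induction on the quantifiers with three invariants: variables still to be quantified are
  undefined on both sides, free placeholders are defined, and the induced assignments are related.
  Definedness is stated for \<open>\<chi>1\<close> only, since related assignments share their
  domain.\<close>

lemma sat_quantify_bind_bisimulation:
  assumes \<rho>: "bool_comb \<Sigma> A \<rho>" and A: "A \<subseteq> Args \<Sigma>" and bs: "distinct (map fst bs)"
    and "distinct (map qvar qs)"
    and "\<And>x. x \<in> qvar ` set qs \<Longrightarrow> \<chi>1 (Inr x) = None \<and> \<chi>2 (Inr x) = None"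
    and "free \<Sigma> (quantify qs (bind bs \<rho>)) \<subseteq> dom \<chi>1"
    and "(arg_asg bs \<chi>1 |` A, arg_asg bs \<chi>2 |` A) \<in> Z"
  shows "sat \<Sigma> \<R>1 \<chi>1 (quantify qs (bind bs \<rho>)) \<longleftrightarrow> sat \<Sigma> \<R>2 \<chi>2 (quantify qs (bind bs \<rho>))"
  using assms(4-)
proof (induction qs arbitrary: \<chi>1 \<chi>2)
  case Nil
  have "dom (arg_asg bs \<chi>1 |` A) = A"
    using bs free_bool_comb[OF \<rho>] Nil.prems(3) by (intro arg_asg_bind_total) simp_all
  then have "arg_asg bs \<chi>1 |` A \<in> interp \<R>1 r \<longleftrightarrow> arg_asg bs \<chi>2 |` A \<in> interp \<R>2 r"
    if "r \<in> Rels \<Sigma>" "ar \<Sigma> r = A" for r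
    using bisimulation_interp[OF Nil.prems(4) that(1)] that(2) by argo
  then show ?case
    unfolding quantify.simps by (rule sat_bind_bool_comb_cong[OF \<rho> bs])
next
  case (Cons q qs)
  define x where "x = qvar q"
  define P where "P = {a \<in> A. map_of bs a = Some x}"
  let ?\<psi> = "quantify qs (bind bs \<rho>)"
  have none: "\<chi>1 (Inr x) = None" "\<chi>2 (Inr x) = None"
    using Cons.prems(2)[of x] by (simp_all add: x_def)
  have upd: "arg_asg bs (\<chi>1(Inr x \<mapsto> d1)) |` A = upd_on (arg_asg bs \<chi>1 |` A) P d1"
    "arg_asg bs (\<chi>2(Inr x \<mapsto> d2)) |` A = upd_on (arg_asg bs \<chi>2 |` A) P d2" for d1 d2
    using none by (simp_all only: arg_asg_quantified(1) P_def)
  have "free \<Sigma> ?\<psi> - {Inr x} \<subseteq> dom \<chi>1"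
    using Cons.prems(3) by (cases q) (simp_all add: x_def)
  then have free: "free \<Sigma> ?\<psi> \<subseteq> dom (\<chi>1(Inr x \<mapsto> d1))" for d1
    by auto
  \<comment> \<open>No variable is quantified twice, so \<open>x\<close> is not among the remaining
    ones.\<close>
  have fresh: "(\<chi>1(Inr x \<mapsto> d1)) (Inr y) = None \<and> (\<chi>2(Inr x \<mapsto> d2)) (Inr y) = None"
    if "y \<in> qvar ` set qs" for y d1 d2
    using that Cons.prems(1) Cons.prems(2)[of y] by (cases "y = x") (simp_all add: x_def)
  have IH: "sat \<Sigma> \<R>1 (\<chi>1(Inr x \<mapsto> d1)) ?\<psi> \<longleftrightarrow> sat \<Sigma> \<R>2 (\<chi>2(Inr x \<mapsto> d2)) ?\<psi>"
    if "(upd_on (arg_asg bs \<chi>1 |` A) P d1, upd_on (arg_asg bs \<chi>2 |` A) P d2) \<in> Z" for d1 d2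
  proof (rule Cons.IH)
    show "distinct (map qvar qs)"
      using Cons.prems(1) by simp
    show "(arg_asg bs (\<chi>1(Inr x \<mapsto> d1)) |` A, arg_asg bs (\<chi>2(Inr x \<mapsto> d2)) |` A) \<in> Z"
      using that by (simp only: upd)
  qed (fact fresh free)+
  have "P \<subseteq> Args \<Sigma>"
    using A by (auto simp: P_def)
  moreover have "P \<inter> dom (arg_asg bs \<chi>1 |` A) = {}"
    using none(1) P_def by (rule arg_asg_quantified(2))
  ultimately have
    "\<forall>d1 \<in> Dom \<R>1. \<exists>d2 \<in> Dom \<R>2.
      (upd_on (arg_asg bs \<chi>1 |` A) P d1, upd_on (arg_asg bs \<chi>2 |` A) P d2) \<in> Z"
    "\<forall>d2 \<in> Dom \<R>2. \<exists>d1 \<in> Dom \<R>1.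
      (upd_on (arg_asg bs \<chi>1 |` A) P d1, upd_on (arg_asg bs \<chi>2 |` A) P d2) \<in> Z"
    by (rule bisimulation_step[OF Cons.prems(4)])+
  with IH have
    forward: "\<forall>d1 \<in> Dom \<R>1. \<exists>d2 \<in> Dom \<R>2.
      sat \<Sigma> \<R>1 (\<chi>1(Inr x \<mapsto> d1)) ?\<psi> \<longleftrightarrow> sat \<Sigma> \<R>2 (\<chi>2(Inr x \<mapsto> d2)) ?\<psi>" and
    backward: "\<forall>d2 \<in> Dom \<R>2. \<exists>d1 \<in> Dom \<R>1.
      sat \<Sigma> \<R>1 (\<chi>1(Inr x \<mapsto> d1)) ?\<psi> \<longleftrightarrow> sat \<Sigma> \<R>2 (\<chi>2(Inr x \<mapsto> d2)) ?\<psi>"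
    by meson+
  \<comment> \<open>Both quantifiers use both directions: a witness for \<open>Ex\<close> moves
    right by \<open>forward\<close> and left by \<open>backward\<close>, whereas for
    \<open>All\<close> an arbitrary element of one domain is first matched in the other.\<close>
  show ?case
  proof (cases q)
    case (QEx y)
    then have "quantify (q # qs) (bind bs \<rho>) = Ex x ?\<psi>"
      by (simp add: x_def)
    then show ?thesis
      using forward backward by (simp only: sat.simps) meson
  next
    case (QAll y)
    then have "quantify (q # qs) (bind bs \<rho>) = All x ?\<psi>"
      by (simp add: x_def)
    then show ?thesis
      using forward backward by (simp only: sat.simps) meson
  qed
qed

lemma models_obfol_bisimulation:
  assumes "wf_signature \<Sigma>" and "obfol \<Sigma> \<phi>" and "sentence \<Sigma> \<phi>"
  shows "models \<Sigma> \<R>1 \<phi> \<longleftrightarrow> models \<Sigma> \<R>2 \<phi>"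
  using assms(2,3)
proof (induction rule: obfol.induct)
  case (Prefix qs bs \<rho>)
  then obtain A where \<rho>: "bool_comb \<Sigma> A \<rho>"
    by (auto simp: derived_relation_def)
  \<comment> \<open>A Boolean combination contains at least one relation, and its arity is
    \<open>A\<close>.\<close>
  then have "A \<subseteq> Args \<Sigma>"
    using assms(1) by (induction rule: bool_comb.induct) (auto simp: wf_signature_def)
  then show ?case
    unfolding models_def
    using sat_quantify_bind_bisimulation[OF \<rho>, of bs qs Map.empty Map.empty] Prefix
      bisimulation_empty
    by (simp add: arg_asg_empty quant_prefix_def bind_prefix_def sentence_def)
qed (auto simp: models_def sentence_def)

end

theorem mainTheorem4:
  fixes \<Sigma> :: "('a, 'r) signature"
    and \<R>1 :: "('a, 'r, 'd1) struct"
    and \<R>2 :: "('a, 'r, 'd2) struct"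
    and \<phi> :: "('a, 'r, 'v) fol"
  assumes "wf_signature \<Sigma>"
    and "is_structure \<Sigma> \<R>1"
    and "is_structure \<Sigma> \<R>2"
    and "one_binding_bisimilar \<Sigma> \<R>1 \<R>2"
    and "obfol \<Sigma> \<phi>"
    and "sentence \<Sigma> \<phi>"
  shows "models \<Sigma> \<R>1 \<phi> \<longleftrightarrow> models \<Sigma> \<R>2 \<phi>"
  using assms models_obfol_bisimulation unfolding one_binding_bisimilar_def by blast

end
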